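(* Let $v(x)={}^t\!xQx$ be a positive definite quadratic form on $\mathbb{R}^n$ with symmetric matrix $Q$, let $M\subsetneq[n]$ have $m$ elements, let $\tau=\tau^{(M)}\in\mathbb{R}^M$ and $a\in\mathbb{R}$, and put $q_{a,\tau^{(M)}}=Q_a\cap h(\tau^{(M)})$. (i) If $M\neq\emptyset$, then the quadratic form $\gamma_M(\tau)$ on $\mathbb{R}^M$ is positive definite. (ii) If $a>\gamma_M(\tau)$, then $q_{a,\tau^{(M)}}$ is an ellipsoid in the $(n-m)$-dimensional space $h(\tau^{(M)})$ with center $c^{(M^c)}(\tau)$ and $Q^{(M^c)}$-radius $\sqrt{a-\gamma_M(\tau)}$. (iii) If $a=\gamma_M(\tau)$, then $q_{a,\tau^{(M)}}=\{c^{(M^c)}(\tau)\}$. (iv) If $a<\gamma_M(\tau)$, then the set $q_{a,\tau^{(M)}}$ is empty.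
   Context: $n\ge1$, $[n]=\{1,\dots,n\}$, $M^c=[n]\setminus M$. Vectors are columns and ${}^t$ is transpose; for $x\in\mathbb{R}^n$, $x^{(M)}=(x_j)_{j\in M}\in\mathbb{R}^M$. $Q^{(M)}$ is the principal submatrix of $Q$ with rows and columns indexed by $M$, and $Q^{(M^c\times M)}$ is the submatrix with rows indexed by $M^c$ and columns indexed by $M$. $Q_a=\{x\in\mathbb{R}^n\mid v(x)=a\}$. For $\tau\in\mathbb{R}^M$, $h(\tau^{(M)})=\{x\in\mathbb{R}^n\mid x_j=\tau_j,\ j\in M\}$ (so $h=\mathbb{R}^n$ if $M=\emptyset$). $c^{(M^c)}(\tau)\in\mathbb{R}^n$ is the vector whose $j$-th component is $\tau_j$ for $j\in M$ and whose components indexed by $M^c$ form the unique solution $y\in\mathbb{R}^{M^c}$ of $Q^{(M^c)}y=-Q^{(M^c\times M)}\tau$. Denoting that solution by $c_{M^c}(\tau)$, one sets $\gamma_M(\tau)={}^t\tau\,Q^{(M)}\tau-{}^tc_{M^c}(\tau)\,Q^{(M^c)}c_{M^c}(\tau)$ (and $\gamma_\emptyset=0$). "Ellipsoid in $h(\tau^{(M)})$ with center $c$ and $Q^{(M^c)}$-radius $\rho>0$" means the set of $x\in h(\tau^{(M)})$ such that $z=x-c$ satisfies ${}^tz^{(M^c)}Q^{(M^c)}z^{(M^c)}=\rho^2$; in a one-dimensional affine space it is a two-point set with midpoint $c$. *)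

theory Defs
  imports "HOL-Analysis.Analysis"
begin

(* The index set [n] is the finite type 'n.  For a set A of indices, R^A is the set of real
   functions on A, made canonical by extensionality: its elements take the value undefined
   outside A, so that equality in R^A is componentwise equality on A. *)
abbreviation coord_space :: "'n set \<Rightarrow> ('n \<Rightarrow> real) set"
  where "coord_space A \<equiv> A \<rightarrow>\<^sub>E UNIV"

definition subvec :: "'n::finite set \<Rightarrow> real ^ 'n \<Rightarrow> 'n \<Rightarrow> real"
  where "subvec A x = (\<lambda>i\<in>A. x $ i)"

(* The product of the submatrix of Q with rows A and columns B with a vector of R^B. *)
definition submat_mult :: "real ^ 'n ^ 'n::finite \<Rightarrow> 'n set \<Rightarrow> 'n set \<Rightarrow> ('n \<Rightarrow> real) \<Rightarrow> 'n \<Rightarrow> real"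
  where "submat_mult Q A B y = (\<lambda>i\<in>A. \<Sum>j\<in>B. Q $ i $ j * y j)"

(* The quadratic form on R^A given by the principal submatrix of Q indexed by A. *)
definition subform :: "real ^ 'n ^ 'n::finite \<Rightarrow> 'n set \<Rightarrow> ('n \<Rightarrow> real) \<Rightarrow> real"
  where "subform Q A y = (\<Sum>i\<in>A. y i * submat_mult Q A A y i)"

definition quadratic_form_on :: "'n::finite set \<Rightarrow> (('n \<Rightarrow> real) \<Rightarrow> real) \<Rightarrow> bool"
  where "quadratic_form_on A f \<longleftrightarrow>
    (\<exists>G :: real ^ 'n ^ 'n. transpose G = G \<and> (\<forall>y\<in>coord_space A. f y = subform G A y))"

definition pos_def_form_on :: "'n::finite set \<Rightarrow> (('n \<Rightarrow> real) \<Rightarrow> real) \<Rightarrow> bool"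
  where "pos_def_form_on A f \<longleftrightarrow>
    quadratic_form_on A f \<and> (\<forall>y\<in>coord_space A. y \<noteq> (\<lambda>i\<in>A. 0) \<longrightarrow> 0 < f y)"

definition qform :: "real ^ 'n ^ 'n::finite \<Rightarrow> real ^ 'n \<Rightarrow> real"
  where "qform Q x = x \<bullet> (Q *v x)"

definition pos_def_sym :: "real ^ 'n ^ 'n::finite \<Rightarrow> bool"
  where "pos_def_sym Q \<longleftrightarrow> transpose Q = Q \<and> (\<forall>x. x \<noteq> 0 \<longrightarrow> 0 < qform Q x)"

definition quadric :: "real ^ 'n ^ 'n::finite \<Rightarrow> real \<Rightarrow> (real ^ 'n) set"
  where "quadric Q a = {x. qform Q x = a}"

definition coord_flat :: "'n::finite set \<Rightarrow> ('n \<Rightarrow> real) \<Rightarrow> (real ^ 'n) set"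
  where "coord_flat M \<tau> = {x. \<forall>j\<in>M. x $ j = \<tau> j}"

definition center_part :: "real ^ 'n ^ 'n::finite \<Rightarrow> 'n set \<Rightarrow> ('n \<Rightarrow> real) \<Rightarrow> 'n \<Rightarrow> real"
  where "center_part Q M \<tau> = (THE y. y \<in> coord_space (- M) \<and>
    submat_mult Q (- M) (- M) y = (\<lambda>i\<in>- M. - submat_mult Q (- M) M \<tau> i))"

definition center :: "real ^ 'n ^ 'n::finite \<Rightarrow> 'n set \<Rightarrow> ('n \<Rightarrow> real) \<Rightarrow> real ^ 'n"
  where "center Q M \<tau> = (\<chi> j. if j \<in> M then \<tau> j else center_part Q M \<tau> j)"

definition gamma_form :: "real ^ 'n ^ 'n::finite \<Rightarrow> 'n set \<Rightarrow> ('n \<Rightarrow> real) \<Rightarrow> real"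
  where "gamma_form Q M \<tau> =
    (if M = {} then 0 else subform Q M \<tau> - subform Q (- M) (center_part Q M \<tau>))"

(* E is the ellipsoid in the flat coord_flat M \<tau> with center c and radius \<rho>, measured by
   the principal submatrix of Q indexed by the complement of M. *)
definition is_ellipsoid_in_flat ::
    "real ^ 'n ^ 'n::finite \<Rightarrow> 'n set \<Rightarrow> ('n \<Rightarrow> real) \<Rightarrow> real ^ 'n \<Rightarrow> real \<Rightarrow> (real ^ 'n) set \<Rightarrow> bool"
  where "is_ellipsoid_in_flat Q M \<tau> c \<rho> E \<longleftrightarrow>
    c \<in> coord_flat M \<tau> \<and> 0 < \<rho> \<and>
    E = {x \<in> coord_flat M \<tau>. subform Q (- M) (subvec (- M) (x - c)) = \<rho>\<^sup>2}"

end

theory Submission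
  imports Defs
begin

text \<open>Let \<open>L\<close> invert the map \<open>x \<mapsto> (x\<^sub>i for i \<in> M, (Q x)\<^sub>i for i \<notin> M)\<close>, which is injective because
  \<open>Q\<close> is definite. The center \<open>c\<close> is \<open>L\<close> applied to the extension of \<open>\<tau>\<close> by zero: it agrees with
  \<open>\<tau>\<close> on \<open>M\<close>, and \<open>Q c\<close> vanishes off \<open>M\<close>. Hence \<open>\<gamma>\<^sub>M(\<tau>) = v(c)\<close>, which is a definite form in
  \<open>\<tau>\<close> since \<open>L\<close> is linear and injective; and for \<open>x\<close> in the flat, \<open>z = x - c\<close> vanishes on \<open>M\<close>, so
  that \<open>z\<close> is \<open>Q\<close>-orthogonal to \<open>c\<close> and \<open>v(x) = \<gamma>\<^sub>M(\<tau>) + v(z)\<close>.\<close>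

definition extend_zero :: "'n::finite set \<Rightarrow> ('n \<Rightarrow> real) \<Rightarrow> real ^ 'n"
  where "extend_zero M \<tau> = (\<chi> i. if i \<in> M then \<tau> i else 0)"

text \<open>The matrix of the map that \<open>L\<close> inverts. Replacing whole rows keeps a square
  matrix over the full index type, although \<open>M\<close> and its complement are only
  sets.\<close>

definition mixed_matrix :: "real ^ 'n ^ 'n::finite \<Rightarrow> 'n set \<Rightarrow> real ^ 'n ^ 'n"
  where "mixed_matrix Q M = (\<chi> i. if i \<in> M then axis i 1 else Q $ i)"

lemma extend_zero_nth: "extend_zero M \<tau> $ i = (if i \<in> M then \<tau> i else 0)"
  by (simp add: extend_zero_def)

lemma mixed_matrix_mult:
  "(mixed_matrix Q M *v x) $ i = (if i \<in> M then x $ i else (Q *v x) $ i)"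
  by (simp add: mixed_matrix_def matrix_vector_mul_component inner_axis')

lemma inner_eq_sum_on:
  fixes x y :: "real ^ 'n"
  assumes "\<And>i. i \<notin> A \<Longrightarrow> x $ i * y $ i = 0"
  shows "x \<bullet> y = (\<Sum>i\<in>A. x $ i * y $ i)"
  unfolding inner_vec_def inner_real_def
  by (rule sum.mono_neutral_right) (use assms in auto)

lemma matrix_vector_mult_split:
  fixes Q :: "real ^ 'n ^ 'm"
  shows "(Q *v x) $ i = (\<Sum>j\<in>M. Q $ i $ j * x $ j) + (\<Sum>j\<in>- M. Q $ i $ j * x $ j)"
  unfolding matrix_vector_mult_def
  by (simp add: sum.union_disjoint[symmetric] Compl_partition)

lemma qform_eq_subform:
  assumes "\<And>i. i \<notin> A \<Longrightarrow> x $ i = 0"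
  shows "qform Q x = subform Q A (($) x)"
proof -
  have "(Q *v x) $ i = (\<Sum>j\<in>A. Q $ i $ j * x $ j)" for i
    using assms by (subst matrix_vector_mult_split[of _ _ _ A]) simp
  moreover have "qform Q x = (\<Sum>i\<in>A. x $ i * (Q *v x) $ i)"
    unfolding qform_def by (rule inner_eq_sum_on) (use assms in simp)
  ultimately show ?thesis
    by (simp add: subform_def submat_mult_def)
qed

lemma subform_cong:
  assumes "\<And>i. i \<in> A \<Longrightarrow> x i = y i"
  shows "subform Q A x = subform Q A y"
  unfolding subform_def submat_mult_def by (intro sum.cong) (use assms in auto)

section \<open>Consequences of positive definiteness\<close>

lemma qform_eq_0_iff:
  assumes "pos_def_sym Q"
  shows "qform Q x = 0 \<longleftrightarrow> x = 0"
proof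
  assume "qform Q x = 0"
  with assms show "x = 0" unfolding pos_def_sym_def by (metis less_irrefl)
qed (simp add: qform_def)

lemma qform_nonneg:
  assumes "pos_def_sym Q"
  shows "0 \<le> qform Q x"
proof (cases "x = 0")
  case False
  with assms show ?thesis unfolding pos_def_sym_def by (simp add: less_imp_le)
qed (simp add: qform_def)

lemma qform_add_orthogonal:
  assumes "transpose Q = Q" and "z \<bullet> (Q *v c) = 0"
  shows "qform Q (c + z) = qform Q c + qform Q z"
proof -
  have "c \<bullet> (Q *v z) = 0"
    using assms by (metis dot_lmul_matrix inner_commute vector_transpose_matrix)
  with assms(2) show ?thesis
    by (simp add: qform_def matrix_vector_right_distrib inner_add)
qed

text \<open>Every summand of the inner product of x and Q x has a zero factor, so v(x) is an empty
  sum. This gives both injectivity of the mixed system and uniqueness of the center.\<close>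

lemma pos_def_vanishing:
  assumes "pos_def_sym Q" and "\<And>i. i \<in> M \<Longrightarrow> x $ i = 0" and "\<And>i. i \<notin> M \<Longrightarrow> (Q *v x) $ i = 0"
  shows "x = 0"
proof -
  have "qform Q x = (\<Sum>i\<in>{}. x $ i * (Q *v x) $ i)"
    unfolding qform_def by (rule inner_eq_sum_on) (use assms in auto)
  with assms(1) show ?thesis by (simp add: qform_eq_0_iff)
qed

lemma invertible_mixed_matrix:
  assumes "pos_def_sym Q"
  shows "invertible (mixed_matrix Q M)"
  unfolding invertible_left_inverse matrix_left_invertible_ker
proof (intro allI impI)
  fix x assume x: "mixed_matrix Q M *v x = 0"
  have "(if i \<in> M then x $ i else (Q *v x) $ i) = 0" for i
    using arg_cong[OF x, of "\<lambda>v. v $ i"] by (simp add: mixed_matrix_mult)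
  then show "x = 0"
    by (intro pos_def_vanishing[OF assms, of M]) (metis, metis)
qed

text \<open>The vector \<open>c\<close> itself supplies existence for the definite description.
  Uniqueness holds because two candidates differ by a vector that vanishes on \<open>M\<close> and
  whose image under \<open>Q\<close> vanishes off \<open>M\<close>.\<close>

lemma center_eqI:
  assumes Q: "pos_def_sym Q"
    and on: "\<And>i. i \<in> M \<Longrightarrow> c $ i = \<tau> i"
    and off: "\<And>i. i \<notin> M \<Longrightarrow> (Q *v c) $ i = 0"
  shows "center Q M \<tau> = c" and "center_part Q M \<tau> = subvec (- M) c"
proof -
  let ?P = "\<lambda>y. y \<in> coord_space (- M) \<and>
    submat_mult Q (- M) (- M) y = (\<lambda>i\<in>- M. - submat_mult Q (- M) M \<tau> i)"
  \<comment> \<open>With its right-hand side moved over, the block system consists of the rows off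
    \<open>M\<close> of \<open>Q\<close> applied to the vector glued from \<tau> and
    \<open>y\<close>.\<close>
  have *: "submat_mult Q (- M) (- M) y = (\<lambda>i\<in>- M. - submat_mult Q (- M) M \<tau> i)
      \<longleftrightarrow> (\<forall>i. i \<notin> M \<longrightarrow> (Q *v (\<chi> j. if j \<in> M then \<tau> j else y j)) $ i = 0)" for y
  proof -
    have "(Q *v (\<chi> j. if j \<in> M then \<tau> j else y j)) $ i
        = (\<Sum>j\<in>M. Q $ i $ j * \<tau> j) + (\<Sum>j\<in>- M. Q $ i $ j * y j)" for i
      by (subst matrix_vector_mult_split[of _ _ _ M]) simp
    then show ?thesis
      by (auto simp: submat_mult_def fun_eq_iff restrict_def eq_neg_iff_add_eq_0 add.commute)
  qed
  have c: "(\<chi> j. if j \<in> M then \<tau> j else subvec (- M) c j) = c"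
    using on by (simp add: vec_eq_iff subvec_def)
  show part: "center_part Q M \<tau> = subvec (- M) c"
    unfolding center_part_def
  proof (rule the_equality)
    show "?P (subvec (- M) c)"
      using off by (simp only: * c) (simp add: subvec_def)
  next
    fix y assume y: "?P y"
    let ?x = "\<chi> j. if j \<in> M then \<tau> j else y j"
    have "?x - c = 0"
      using y off on
      by (intro pos_def_vanishing[OF Q, of M]) (simp_all add: * matrix_vector_mult_diff_distrib)
    then have "c $ j = y j" if "j \<notin> M" for j
      using that by (simp add: vec_eq_iff) metis
    \<comment> \<open>Both functions are \<open>undefined\<close> on \<open>M\<close>, so agreement
      off \<open>M\<close> suffices.\<close>
    then show "y = subvec (- M) c"
      using y by (intro extensionalityI[of _ "- M"]) (auto simp: subvec_def PiE_def)
  qed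
  show "center Q M \<tau> = c"
    unfolding center_def part by (rule c)
qed

section \<open>The center as a linear function of \<tau>\<close>

lemma matrix_inv_right:
  fixes A :: "'a::semiring_1 ^ 'n ^ 'm"
  assumes "invertible A"
  shows "A ** matrix_inv A = mat 1"
  using someI_ex[OF assms[unfolded invertible_def]] by (simp add: matrix_inv_def)

lemma center_eq_matrix_inv:
  assumes "pos_def_sym Q"
  shows "center Q M \<tau> = matrix_inv (mixed_matrix Q M) *v extend_zero M \<tau>"
proof -
  let ?c = "matrix_inv (mixed_matrix Q M) *v extend_zero M \<tau>"
  have eq: "mixed_matrix Q M *v ?c = extend_zero M \<tau>"
    by (simp add: matrix_vector_mul_assoc matrix_inv_right invertible_mixed_matrix[OF assms])
  have *: "(if i \<in> M then ?c $ i else (Q *v ?c) $ i) = extend_zero M \<tau> $ i" for i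
    unfolding mixed_matrix_mult[symmetric] eq ..
  show ?thesis
  proof (rule center_eqI(1)[OF assms])
    show "?c $ i = \<tau> i" if "i \<in> M" for i
      using *[of i] that by (simp add: extend_zero_nth)
    show "(Q *v ?c) $ i = 0" if "i \<notin> M" for i
      using *[of i] that by (simp add: extend_zero_nth)
  qed
qed

lemma mixed_matrix_center:
  assumes "pos_def_sym Q"
  shows "mixed_matrix Q M *v center Q M \<tau> = extend_zero M \<tau>"
  by (simp add: center_eq_matrix_inv[OF assms] matrix_vector_mul_assoc matrix_inv_right
      invertible_mixed_matrix[OF assms])

lemma center_on:
  assumes "i \<in> M"
  shows "center Q M \<tau> $ i = \<tau> i"
  using assms by (simp add: center_def)

lemma center_off:
  assumes "pos_def_sym Q" and "i \<notin> M"
  shows "(Q *v center Q M \<tau>) $ i = 0"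
  using arg_cong[OF mixed_matrix_center[OF assms(1), of M \<tau>], of "\<lambda>v. v $ i"] assms(2)
  by (simp add: mixed_matrix_mult extend_zero_nth)

text \<open>Only the rows in \<open>M\<close> contribute to v(c). They give the form of \<tau> plus
  a mixed term, which the defining equation of the center turns into minus the form of the part off
  \<open>M\<close>.\<close>

lemma gamma_form_eq_qform_center:
  assumes Q: "pos_def_sym Q"
  shows "gamma_form Q M \<tau> = qform Q (center Q M \<tau>)"
proof -
  let ?c = "center Q M \<tau>"
  have sym: "Q $ i $ j = Q $ j $ i" for i j
  proof -
    have "transpose Q $ j $ i = Q $ i $ j"
      by (simp add: transpose_def)
    with Q show ?thesis by (simp add: pos_def_sym_def)
  qed
  have off: "(\<Sum>j\<in>M. Q $ i $ j * \<tau> j) = - (\<Sum>j\<in>- M. Q $ i $ j * ?c $ j)" if "i \<notin> M" for i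
    using center_off[OF Q that, of \<tau>]
    by (simp add: matrix_vector_mult_split[of _ _ _ M] center_on)
  have "qform Q ?c = (\<Sum>i\<in>M. ?c $ i * (Q *v ?c) $ i)"
    unfolding qform_def by (rule inner_eq_sum_on) (simp add: center_off[OF Q])
  also have "\<dots> = subform Q M \<tau> + (\<Sum>i\<in>M. \<Sum>j\<in>- M. \<tau> i * (Q $ i $ j * ?c $ j))"
    by (simp add: matrix_vector_mult_split[of _ _ _ M] center_on subform_def submat_mult_def
        distrib_left sum.distrib sum_distrib_left)
  \<comment> \<open>Symmetry of \<open>Q\<close> turns the mixed block into rows off
    \<open>M\<close>, where \<open>off\<close> applies.\<close>
  also have "(\<Sum>i\<in>M. \<Sum>j\<in>- M. \<tau> i * (Q $ i $ j * ?c $ j))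
      = (\<Sum>j\<in>- M. ?c $ j * (\<Sum>i\<in>M. Q $ j $ i * \<tau> i))"
    unfolding sum_distrib_left
    by (subst sum.swap) (simp add: sym mult_ac)
  also have "\<dots> = - subform Q (- M) (($) ?c)"
    by (simp add: off subform_def submat_mult_def sum_negf)
  also have "subform Q (- M) (($) ?c) = subform Q (- M) (center_part Q M \<tau>)"
    by (rule subform_cong) (simp add: center_def)
  finally have *: "qform Q ?c = subform Q M \<tau> - subform Q (- M) (center_part Q M \<tau>)"
    by simp
  show ?thesis
  \<comment> \<open>For empty \<open>M\<close> the value 0 is a convention; it agrees with v(c)
    because Q c = 0 forces c = 0.\<close>
  proof (cases "M = {}")
    case True
    then have "?c = 0"
      by (intro pos_def_vanishing[OF Q, of M]) (simp_all add: center_off[OF Q])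
    with True show ?thesis by (simp add: gamma_form_def qform_def)
  qed (simp add: gamma_form_def *)
qed

lemma pos_def_form_gamma:
  assumes Q: "pos_def_sym Q"
  shows "pos_def_form_on M (gamma_form Q M)"
  unfolding pos_def_form_on_def quadratic_form_on_def
proof (intro conjI exI ballI impI)
  let ?L = "matrix_inv (mixed_matrix Q M)"
  \<comment> \<open>The center is \<open>?L\<close> applied to the extended \<tau>, so pulling
    \<open>Q\<close> back along \<open>?L\<close> represents v(c) as a form in \<tau>.\<close>
  let ?G = "transpose ?L ** Q ** ?L"
  show "transpose ?G = ?G"
    using Q by (simp add: pos_def_sym_def matrix_transpose_mul matrix_mul_assoc)
  fix y
  have "gamma_form Q M y = qform ?G (extend_zero M y)"
    unfolding gamma_form_eq_qform_center[OF Q] center_eq_matrix_inv[OF Q] qform_def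
    by (metis dot_lmul_matrix matrix_vector_mul_assoc transpose_matrix_vector inner_commute)
  also have "\<dots> = subform ?G M (($) (extend_zero M y))"
    by (rule qform_eq_subform) (simp add: extend_zero_nth)
  also have "\<dots> = subform ?G M y"
    by (rule subform_cong) (simp add: extend_zero_nth)
  finally show "gamma_form Q M y = subform ?G M y" .
next
  fix y assume y: "y \<in> coord_space M" "y \<noteq> (\<lambda>i\<in>M. 0)"
  \<comment> \<open>Outside \<open>M\<close> both \<open>y\<close> and the zero function are
    \<open>undefined\<close>, so they differ inside \<open>M\<close>; the center then inherits a
    nonzero component.\<close>
  have "\<exists>i\<in>M. y i \<noteq> 0"
  proof (rule ccontr)
    assume "\<not> ?thesis"
    then have "y = (\<lambda>i\<in>M. 0)"
      using y(1) by (intro extensionalityI[of _ M]) (auto simp: PiE_def)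
    with y(2) show False by simp
  qed
  then have "center Q M y \<noteq> 0"
    by (metis center_on zero_index)
  with Q show "0 < gamma_form Q M y"
    by (simp add: gamma_form_eq_qform_center[OF Q]) (simp add: pos_def_sym_def)
qed

section \<open>The flat and its sections by the quadric\<close>

lemma center_in_coord_flat: "center Q M \<tau> \<in> coord_flat M \<tau>"
  by (simp add: coord_flat_def center_on)

lemma qform_on_coord_flat:
  assumes Q: "pos_def_sym Q" and x: "x \<in> coord_flat M \<tau>"
  shows "qform Q x = gamma_form Q M \<tau> + qform Q (x - center Q M \<tau>)"
proof -
  let ?c = "center Q M \<tau>"
  have "(x - ?c) \<bullet> (Q *v ?c) = (\<Sum>i\<in>{}. (x - ?c) $ i * (Q *v ?c) $ i)"
  proof (rule inner_eq_sum_on)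
    show "(x - ?c) $ i * (Q *v ?c) $ i = 0" for i
      using x by (cases "i \<in> M") (simp_all add: coord_flat_def center_on center_off[OF Q])
  qed
  then have "qform Q (?c + (x - ?c)) = qform Q ?c + qform Q (x - ?c)"
    using Q by (intro qform_add_orthogonal) (simp_all add: pos_def_sym_def)
  then show ?thesis by (simp add: gamma_form_eq_qform_center[OF Q])
qed

text \<open>Serves the dimension count. The double negation \<open>i \<notin> - M\<close> gives the
  direction space the shape treated by \<open>dim_substandard_cart\<close>.\<close>

lemma coord_flat_eq_translation:
  "coord_flat M \<tau> = (+) (extend_zero M \<tau>) ` {x. \<forall>i. i \<notin> - M \<longrightarrow> x $ i = 0}"
proof (intro set_eqI iffI)
  fix x assume "x \<in> coord_flat M \<tau>"
  then show "x \<in> (+) (extend_zero M \<tau>) ` {x. \<forall>i. i \<notin> - M \<longrightarrow> x $ i = 0}"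
    by (intro image_eqI[of _ _ "x - extend_zero M \<tau>"]) (simp_all add: coord_flat_def extend_zero_nth)
qed (auto simp: coord_flat_def extend_zero_nth)

lemma affine_coord_flat: "affine (coord_flat M \<tau>)"
  by (auto simp: affine_def coord_flat_def distrib_right[symmetric])

lemma aff_dim_coord_flat:
  fixes M :: "'n::finite set"
  shows "aff_dim (coord_flat M \<tau>) = int CARD('n) - int (card M)"
proof -
  let ?S = "{x :: real ^ 'n. \<forall>i. i \<notin> - M \<longrightarrow> x $ i = 0}"
  have "subspace ?S"
    by (auto simp: subspace_def)
  then have "aff_dim (coord_flat M \<tau>) = int (dim ?S)"
    unfolding coord_flat_eq_translation aff_dim_translation_eq by (rule aff_dim_subspace)
  also have "dim ?S = card (- M)"
    using dim_substandard_cart[of "- M", where 'a = real] by (simp only: dim_vec_eq)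
  also have "int (card (- M)) = int CARD('n) - int (card M)"
    unfolding Compl_eq_Diff_UNIV by (subst card_Diff_subset) (simp_all add: card_mono of_nat_diff)
  finally show ?thesis .
qed

theorem theorem2p2p1:
  fixes Q :: "real ^ 'n ^ 'n" and M :: "'n set" and m :: nat
    and \<tau> :: "'n \<Rightarrow> real" and a :: real
  assumes "pos_def_sym Q"
    and "M \<subset> UNIV" and "card M = m"
    and "\<tau> \<in> coord_space M"
  shows "(M \<noteq> {} \<longrightarrow> pos_def_form_on M (gamma_form Q M)) \<and>
    (a > gamma_form Q M \<tau> \<longrightarrow>
      affine (coord_flat M \<tau>) \<and>
      aff_dim (coord_flat M \<tau>) = int CARD('n) - int m \<and>
      is_ellipsoid_in_flat Q M \<tau> (center Q M \<tau>) (sqrt (a - gamma_form Q M \<tau>))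
        (quadric Q a \<inter> coord_flat M \<tau>)) \<and>
    (a = gamma_form Q M \<tau> \<longrightarrow> quadric Q a \<inter> coord_flat M \<tau> = {center Q M \<tau>}) \<and>
    (a < gamma_form Q M \<tau> \<longrightarrow> quadric Q a \<inter> coord_flat M \<tau> = {})"
proof (intro conjI impI)
  note Q = assms(1)
  let ?c = "center Q M \<tau>" and ?g = "gamma_form Q M \<tau>"
  \<comment> \<open>Cases (ii) to (iv) all concern this level set of v about the center; only the
    sign of the level differs.\<close>
  have level: "quadric Q a \<inter> coord_flat M \<tau> = {x \<in> coord_flat M \<tau>. qform Q (x - ?c) = a - ?g}"
    by (auto simp: quadric_def qform_on_coord_flat[OF Q])
  show "pos_def_form_on M (gamma_form Q M)"
    by (rule pos_def_form_gamma[OF Q])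
  show "affine (coord_flat M \<tau>)"
    by (rule affine_coord_flat)
  show "aff_dim (coord_flat M \<tau>) = int CARD('n) - int m"
    using aff_dim_coord_flat assms(3) by blast
  show "is_ellipsoid_in_flat Q M \<tau> ?c (sqrt (a - ?g)) (quadric Q a \<inter> coord_flat M \<tau>)"
    if "a > ?g"
  proof -
    \<comment> \<open>On the flat the difference from the center vanishes on \<open>M\<close>, so
      only the principal block off \<open>M\<close> enters.\<close>
    have "qform Q (x - ?c) = subform Q (- M) (subvec (- M) (x - ?c))" if "x \<in> coord_flat M \<tau>" for x
    proof -
      have "qform Q (x - ?c) = subform Q (- M) (($) (x - ?c))"
        using that by (intro qform_eq_subform) (simp add: coord_flat_def center_on)
      also have "\<dots> = subform Q (- M) (subvec (- M) (x - ?c))"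
        by (rule subform_cong) (simp add: subvec_def)
      finally show ?thesis .
    qed
    with that show ?thesis
      unfolding is_ellipsoid_in_flat_def level by (auto simp: center_in_coord_flat)
  qed
  show "quadric Q a \<inter> coord_flat M \<tau> = {?c}" if "a = ?g"
    using that unfolding level by (auto simp: qform_eq_0_iff[OF Q] center_in_coord_flat)
  show "quadric Q a \<inter> coord_flat M \<tau> = {}" if "a < ?g"
  proof -
    have "qform Q (x - ?c) \<noteq> a - ?g" for x
      using that qform_nonneg[OF Q, of "x - ?c"] by linarith
    then show ?thesis unfolding level by blast
  qed
qed

end
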